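(* Let $n\ge 2$ be an integer and let $P_n$ be the path on $n$ vertices. Then $\gamma_{Zg}(P_n)=\left\lceil\frac{n}{2}\right\rceil-1$ if $n\equiv 3\pmod 4$, and $\gamma_{Zg}(P_n)=\left\lceil\frac{n}{2}\right\rceil$ otherwise.
   Context: $N(v)$ and $N[v]=N(v)\cup\{v\}$ denote the open and closed neighborhood of a vertex $v$. Z-domination game: two players, Dominator and Staller, alternately select vertices $v_1,v_2,\ldots$ of an isolate-free graph $G$. The $i$-th move $v_i$ is legal if $N(v_i)\setminus\bigcup_{j=1}^{i-1}N[v_j]\neq\emptyset$. The game ends when no legal move is available. Dominator wants to minimize the total number of moves, Staller wants to maximize it. $\gamma_{Zg}(G)$ is the total number of moves played (by both players) when Dominator moves first and both players play optimally. *)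

theory Defs
  imports Complex_Main "Graph_Theory.Pair_Digraph"
begin

text \<open>
  A finite simple graph is a \<^locale>\<open>pair_graph\<close>: every edge is represented by its two
  opposite arcs.
\<close>

definition open_nbhd :: "'a pair_pre_digraph \<Rightarrow> 'a \<Rightarrow> 'a set" where
  "open_nbhd G v = {u. (v, u) \<in> parcs G}"

definition closed_nbhd :: "'a pair_pre_digraph \<Rightarrow> 'a \<Rightarrow> 'a set" where
  "closed_nbhd G v = open_nbhd G v \<union> {v}"

definition isolate_free :: "'a pair_pre_digraph \<Rightarrow> bool" where
  "isolate_free G \<longleftrightarrow> (\<forall>v \<in> pverts G. open_nbhd G v \<noteq> {})"

definition z_legal :: "'a pair_pre_digraph \<Rightarrow> 'a list \<Rightarrow> 'a set" where
  "z_legal G vs = {v \<in> pverts G. open_nbhd G v - (\<Union>u \<in> set vs. closed_nbhd G u) \<noteq> {}}"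

lemma z_legal_not_played: "v \<in> z_legal G vs \<Longrightarrow> v \<in> pverts G - set vs"
  by (auto simp: z_legal_def closed_nbhd_def)

datatype player = Dominator | Staller

text \<open>
  \<open>z_remaining G p vs\<close> is the number of moves still to be made under optimal play (backward
  induction) when the moves \<open>vs\<close> have been played so far, in this order, and player \<open>p\<close> is next.
  The value for infinite graphs is a dummy that makes the function total.
\<close>

function z_remaining :: "'a pair_pre_digraph \<Rightarrow> player \<Rightarrow> 'a list \<Rightarrow> nat" where
  "z_remaining G p vs =
     (if infinite (pverts G) \<or> z_legal G vs = {} then 0
      else 1 + (case p of
          Dominator \<Rightarrow> Min ((\<lambda>v. z_remaining G Staller (vs @ [v])) ` z_legal G vs)
        | Staller \<Rightarrow> Max ((\<lambda>v. z_remaining G Dominator (vs @ [v])) ` z_legal G vs)))"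
  by pat_completeness auto

termination
proof (relation "measure (\<lambda>(G, p, vs). card (pverts G - set vs))", goal_cases)
  case 1
  show ?case by simp
next
  case (2 G p vs v)
  then have "finite (pverts G - set vs)" and "v \<in> pverts G - set vs"
    using z_legal_not_played[of v G vs] by auto
  then have "card (pverts G - set vs - {v}) < card (pverts G - set vs)"
    by (rule card_Diff1_less)
  then show ?case by (simp flip: Diff_insert)
next
  case (3 G p vs v)
  then have "finite (pverts G - set vs)" and "v \<in> pverts G - set vs"
    using z_legal_not_played[of v G vs] by auto
  then have "card (pverts G - set vs - {v}) < card (pverts G - set vs)"
    by (rule card_Diff1_less)
  then show ?case by (simp flip: Diff_insert)
qed

declare z_remaining.simps [simp del]

definition gamma_Zg :: "'a pair_pre_digraph \<Rightarrow> nat" where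
  "gamma_Zg G = z_remaining G Dominator []"

definition path_graph :: "nat \<Rightarrow> nat pair_pre_digraph" where
  "path_graph n = \<lparr> pverts = {1..n},
     parcs = {(i, j). i \<in> {1..n} \<and> j \<in> {1..n} \<and> (j = i + 1 \<or> i = j + 1)} \<rparr>"

lemma pair_graph_path_graph: "pair_graph (path_graph n)"
proof -
  have "finite (parcs (path_graph n))"
    by (rule finite_subset[of _ "{1..n} \<times> {1..n}"]) (auto simp: path_graph_def)
  then show ?thesis
    by unfold_locales (auto simp: path_graph_def symmetric_def intro!: symI)
qed

lemma isolate_free_path_graph:
  assumes "n \<ge> 2"
  shows "isolate_free (path_graph n)"
  unfolding isolate_free_def
proof
  fix i assume "i \<in> pverts (path_graph n)"
  with assms have "(if i = 1 then 2 else i - 1) \<in> open_nbhd (path_graph n) i"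
    by (auto simp: path_graph_def open_nbhd_def)
  then show "open_nbhd (path_graph n) i \<noteq> {}" by blast
qed

end

theory Submission
  imports Defs
begin

text \<open>
  Let \<open>U\<close> be the set of undominated vertices. Both bounds express that a round of two moves
  costs four units of a potential: three for Dominator's move and one for Staller's.

  Upper bound: the potential is \<open>card U\<close> plus twice the number of maximal runs of \<open>U\<close>. A move
  that creates a new run dominates three new vertices, so every move lowers the potential.
  By playing just below the largest undominated vertex Dominator lowers it by three: either three
  new vertices are dominated, or a whole run disappears.

  Lower bound: the potential is \<open>card U\<close>, which no move lowers by more than three. Since each move
  dominates a vertex and all its neighbours, two runs of \<open>U\<close> are at least two vertices apart, and
  Staller can dominate a single new vertex by playing the dominated neighbour of the end of a run.
\<close>

section \<open>Optimal play and potential bounds on a general graph\<close>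

definition undominated :: "'a pair_pre_digraph \<Rightarrow> 'a list \<Rightarrow> 'a set" where
  "undominated G vs = pverts G - (\<Union>u \<in> set vs. closed_nbhd G u)"

lemma undominated_snoc: "undominated G (vs @ [v]) = undominated G vs - closed_nbhd G v"
  by (auto simp: undominated_def)

lemma finite_z_legal: "finite (pverts G) \<Longrightarrow> finite (z_legal G vs)"
  by (simp add: z_legal_def)

lemma z_remaining_no_move: "z_legal G vs = {} \<Longrightarrow> z_remaining G p vs = 0"
  by (simp add: z_remaining.simps)

lemma z_remaining_Dominator_le:
  assumes "finite (pverts G)" "v \<in> z_legal G vs"
  shows "z_remaining G Dominator vs \<le> Suc (z_remaining G Staller (vs @ [v]))"
  using assms by (subst z_remaining.simps) (auto simp: finite_z_legal intro!: Min_le)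

lemma z_remaining_Staller_ge:
  assumes "finite (pverts G)" "v \<in> z_legal G vs"
  shows "Suc (z_remaining G Dominator (vs @ [v])) \<le> z_remaining G Staller vs"
  using assms by (subst (2) z_remaining.simps) (auto simp: finite_z_legal intro!: Max_ge)

lemma z_remaining_Dominator_attained:
  assumes "finite (pverts G)" "z_legal G vs \<noteq> {}"
  obtains v where "v \<in> z_legal G vs"
    "z_remaining G Dominator vs = Suc (z_remaining G Staller (vs @ [v]))"
proof -
  let ?V = "(\<lambda>v. z_remaining G Staller (vs @ [v])) ` z_legal G vs"
  have "Min ?V \<in> ?V"
    using assms by (intro Min_in) (auto simp: finite_z_legal)
  moreover have "z_remaining G Dominator vs = Suc (Min ?V)"
    using assms by (subst z_remaining.simps) simp
  ultimately show ?thesis using that by auto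
qed

lemma z_remaining_Staller_attained:
  assumes "finite (pverts G)" "z_legal G vs \<noteq> {}"
  obtains v where "v \<in> z_legal G vs"
    "z_remaining G Staller vs = Suc (z_remaining G Dominator (vs @ [v]))"
proof -
  let ?V = "(\<lambda>v. z_remaining G Dominator (vs @ [v])) ` z_legal G vs"
  have "Max ?V \<in> ?V"
    using assms by (intro Max_in) (auto simp: finite_z_legal)
  moreover have "z_remaining G Staller vs = Suc (Max ?V)"
    using assms by (subst z_remaining.simps) simp
  ultimately show ?thesis using that by auto
qed

text \<open>While a legal move remains, \<open>w\<close> is at least 3, because Dominator's
  hypothesis covers every such position, whoever is to move. If Dominator starts and always plays
  these moves, a round costs at least 4. Hence Dominator's k-th move needs an initial value of at
  least 4k - 1 and Staller's k-th at least 4k + 2; the formula counts these k.\<close>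

lemma z_remaining_le_potential:
  fixes w :: "'a list \<Rightarrow> nat"
  assumes fin: "finite (pverts G)"
    and Dominator: "\<And>vs. z_legal G vs \<noteq> {} \<Longrightarrow> \<exists>v \<in> z_legal G vs. w (vs @ [v]) + 3 \<le> w vs"
    and Staller: "\<And>vs v. v \<in> z_legal G vs \<Longrightarrow> w (vs @ [v]) < w vs"
  shows "z_remaining G p vs \<le>
    (case p of Dominator \<Rightarrow> (w vs + 1) div 4 + (w vs + 2) div 4 - 1
     | Staller \<Rightarrow> if w vs < 3 then 0 else w vs div 4 + (w vs + 1) div 4)"
proof (induction "w vs" arbitrary: p vs rule: less_induct)
  case less
  show ?case
  proof (cases "z_legal G vs = {}")
    case True
    then show ?thesis by (simp add: z_remaining_no_move)
  next
    case False
    \<comment> \<open>Obtained before the split on the player: on Staller's turn it only shows that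
      \<open>w vs\<close> \<ge> 3.\<close>
    then obtain u where u: "u \<in> z_legal G vs" "w (vs @ [u]) + 3 \<le> w vs"
      using Dominator by blast
    show ?thesis
    proof (cases p)
      case Dominator
      have "z_remaining G Dominator vs \<le> Suc (z_remaining G Staller (vs @ [u]))"
        using fin u(1) by (rule z_remaining_Dominator_le)
      moreover have "z_remaining G Staller (vs @ [u]) \<le>
          (if w (vs @ [u]) < 3 then 0 else w (vs @ [u]) div 4 + (w (vs @ [u]) + 1) div 4)"
        using less[of "vs @ [u]" Staller] u(2) by simp
      \<comment> \<open>Adding 4 raises a quotient by one. Doing so in both summands pays for the
        move just made and for the \<open>- 1\<close> in the bound.\<close>
      moreover have "(w (vs @ [u]) + 4) div 4 \<le> (w vs + 1) div 4"
          "(w (vs @ [u]) + 1 + 4) div 4 \<le> (w vs + 2) div 4"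
        using u(2) by (intro div_le_mono; simp)+
      ultimately show ?thesis
        using Dominator by (simp split: if_splits)
    next
      case Staller
      obtain v where v: "v \<in> z_legal G vs"
          "z_remaining G Staller vs = Suc (z_remaining G Dominator (vs @ [v]))"
        using z_remaining_Staller_attained[OF fin False] .
      have "w (vs @ [v]) < w vs" using v(1) by (rule assms(3))
      moreover from this have "z_remaining G Dominator (vs @ [v]) \<le>
          (w (vs @ [v]) + 1) div 4 + (w (vs @ [v]) + 2) div 4 - 1"
        using less[of "vs @ [v]" Dominator] by simp
      moreover have "(w (vs @ [v]) + 1) div 4 \<le> w vs div 4"
          "(w (vs @ [v]) + 2) div 4 \<le> (w vs + 1) div 4" "(3 + 1) div 4 \<le> (w vs + 1) div 4"
        using calculation(1) u(2) by (intro div_le_mono; simp)+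
      ultimately show ?thesis
        using Staller v(2) u(2) by (auto split: nat_diff_split_asm)
    qed
  qed
qed

text \<open>The dual count: if Dominator starts and Staller uses the guaranteed moves, a round costs
  at most 4. So Dominator has a k-th move if \<open>t\<close> starts at 4k - 3 or more, and Staller
  has one if it starts at 4k or more. Staller's guarantee is available only after a first move,
  hence the condition on \<open>vs\<close> when Staller is next.\<close>

lemma z_remaining_ge_potential:
  fixes t :: "'a list \<Rightarrow> nat"
  assumes fin: "finite (pverts G)"
    and playable: "\<And>vs. t vs > 0 \<Longrightarrow> z_legal G vs \<noteq> {}"
    and Dominator: "\<And>vs v. v \<in> z_legal G vs \<Longrightarrow> t vs \<le> t (vs @ [v]) + 3"
    and Staller: "\<And>vs. vs \<noteq> [] \<Longrightarrow> set vs \<subseteq> pverts G \<Longrightarrow> t vs > 0 \<Longrightarrow>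
      \<exists>v \<in> z_legal G vs. t vs \<le> t (vs @ [v]) + 1"
    and played: "set vs \<subseteq> pverts G" "p = Staller \<Longrightarrow> vs \<noteq> []"
  shows "(case p of Dominator \<Rightarrow> (t vs + 3) div 4 + t vs div 4
     | Staller \<Rightarrow> if t vs = 0 then 0 else (t vs + 2) div 4 + (t vs + 3) div 4)
    \<le> z_remaining G p vs"
  using played
\<comment> \<open>The hypotheses do not force a move to lower \<open>t\<close>, so the induction
  runs on the number of unplayed vertices.\<close>
proof (induction "card (pverts G - set vs)" arbitrary: p vs rule: less_induct)
  case less
  have decreasing: "card (pverts G - set (vs @ [v])) < card (pverts G - set vs)"
    and played_snoc: "set (vs @ [v]) \<subseteq> pverts G" if "v \<in> z_legal G vs" for v
  proof -
    have v: "v \<in> pverts G - set vs" using that by (rule z_legal_not_played)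
    have "card (pverts G - set vs - {v}) < card (pverts G - set vs)"
      using fin v by (intro card_Diff1_less) auto
    then show "card (pverts G - set (vs @ [v])) < card (pverts G - set vs)"
      by (simp flip: Diff_insert)
    show "set (vs @ [v]) \<subseteq> pverts G"
      using v less.prems(1) by simp
  qed
  show ?case
  proof (cases "t vs = 0")
    case True
    then show ?thesis by (cases p) simp_all
  next
    case False
    show ?thesis
    proof (cases p)
      case Dominator
      obtain v where v: "v \<in> z_legal G vs"
          "z_remaining G Dominator vs = Suc (z_remaining G Staller (vs @ [v]))"
        using z_remaining_Dominator_attained[OF fin playable] False by blast
      have "t vs \<le> t (vs @ [v]) + 3" using v(1) by (rule assms(3))
      moreover have "(if t (vs @ [v]) = 0 then 0
          else (t (vs @ [v]) + 2) div 4 + (t (vs @ [v]) + 3) div 4)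
          \<le> z_remaining G Staller (vs @ [v])"
        using less.hyps[OF decreasing[OF v(1)] played_snoc[OF v(1)], of Staller] by simp
      moreover have "(t vs + 3) div 4 \<le> (t (vs @ [v]) + 2 + 4) div 4"
          "t vs div 4 \<le> (t (vs @ [v]) + 3) div 4"
        using calculation(1) by (intro div_le_mono; simp)+
      ultimately show ?thesis
        using Dominator v(2) by (simp split: if_splits)
    next
      case Staller
      then obtain v where v: "v \<in> z_legal G vs" "t vs \<le> t (vs @ [v]) + 1"
        using assms(4)[of vs] less.prems False by auto
      have "Suc (z_remaining G Dominator (vs @ [v])) \<le> z_remaining G Staller vs"
        using fin v(1) by (rule z_remaining_Staller_ge)
      moreover have "(t (vs @ [v]) + 3) div 4 + t (vs @ [v]) div 4
          \<le> z_remaining G Dominator (vs @ [v])"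
        using less.hyps[OF decreasing[OF v(1)] played_snoc[OF v(1)], of Dominator] by simp
      moreover have "(t vs + 2) div 4 \<le> (t (vs @ [v]) + 3) div 4"
          "(t vs + 3) div 4 \<le> (t (vs @ [v]) + 4) div 4"
        using v(2) by (intro div_le_mono; simp)+
      ultimately show ?thesis
        using Staller False by simp
    qed
  qed
qed

section \<open>Maximal runs of consecutive numbers\<close>

definition run_ends :: "nat set \<Rightarrow> nat set" where
  "run_ends U = {x \<in> U. Suc x \<notin> U}"

text \<open>Each maximal run of a finite set is represented by its right end. With weight 2, a split
  that removes three elements still lowers the value by 1, while the loss of a one-element run
  lowers it by 3.\<close>

definition run_potential :: "nat set \<Rightarrow> nat" where
  "run_potential U = card U + 2 * card (run_ends U)"

lemma finite_run_ends: "finite U \<Longrightarrow> finite (run_ends U)"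
  by (simp add: run_ends_def)

text \<open>A new end must be the left neighbour of a removed element and must itself survive, which
  leaves only \<open>v - 2\<close>. So a move creates at most one end.\<close>

lemma run_ends_Diff_subset:
  "run_ends (U - {v - 1, v, v + 1}) \<subseteq> insert (v - 2) (run_ends U)"
  by (auto simp: run_ends_def)

text \<open>A new end \<open>v - 2\<close> forces \<open>v - 1\<close> into \<open>U\<close>. Either
  all three elements are removed, which outweighs the extra run, or the run through
  \<open>v - 1\<close> ended at \<open>v - 1\<close> or \<open>v\<close>, and that end is lost in
  exchange.\<close>

lemma run_potential_decreases:
  assumes fin: "finite U" and v: "v - 1 \<in> U \<or> v + 1 \<in> U"
  shows "run_potential (U - {v - 1, v, v + 1}) < run_potential U"
proof -
  let ?U' = "U - {v - 1, v, v + 1}"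
  note finE = finite_run_ends[OF fin]
  have less: "card ?U' < card U"
    using v fin by (intro psubset_card_mono) auto
  show ?thesis
  proof (cases "run_ends ?U' \<subseteq> run_ends U")
    case True
    then have "card (run_ends ?U') \<le> card (run_ends U)"
      using finE by (intro card_mono)
    with less show ?thesis by (simp add: run_potential_def)
  next
    case False
    then have v2: "v - 2 \<in> ?U'" "v - 2 \<notin> run_ends U"
      using run_ends_Diff_subset[of U v] by (auto simp: run_ends_def)
    \<comment> \<open>For smaller \<open>v\<close>, truncated subtraction makes \<open>v - 2\<close>
      one of the removed elements.\<close>
    then have "v \<ge> 2" by (cases v) auto
    with v2 have v1: "v - 1 \<in> U"
      by (auto simp: run_ends_def Suc_diff_Suc numeral_2_eq_2)
    show ?thesis
    proof (cases "v \<in> U \<and> v + 1 \<in> U")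
      case True
      then have "card U = card ?U' + 3"
        using v1 \<open>v \<ge> 2\<close> fin
        by (subst card_Diff_subset)
          (auto simp: card_insert_if dest: card_mono[of U "{v - 1, v, v + 1}"])
      moreover have "card (run_ends ?U') \<le> card (insert (v - 2) (run_ends U))"
        using run_ends_Diff_subset finE by (intro card_mono) auto
      ultimately show ?thesis
        using finE by (simp add: run_potential_def card_insert_if split: if_splits)
    next
      case False
      have "(if v \<in> U then v else v - 1) \<in> run_ends U"
        using False v1 \<open>v \<ge> 2\<close> by (auto simp: run_ends_def)
      then obtain e where e: "e \<in> run_ends U" "e \<in> {v - 1, v}"
        by (auto split: if_splits)
      have "run_ends ?U' \<subseteq> insert (v - 2) (run_ends U - {e})"
        using run_ends_Diff_subset[of U v] e(2) by (auto simp: run_ends_def)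
      then have "card (run_ends ?U') \<le> card (insert (v - 2) (run_ends U - {e}))"
        using finE by (intro card_mono) auto
      also have "\<dots> \<le> Suc (card (run_ends U - {e}))"
        using finE by (simp add: card_insert_if)
      also have "\<dots> = card (run_ends U)"
        using e(1) finE by (rule card_Suc_Diff1[rotated])
      finally show ?thesis using less by (simp add: run_potential_def)
    qed
  qed
qed

text \<open>The end \<open>v + 1\<close> is always lost. If all three elements are present, they
  give the drop of 3 and the lost end offsets a possible new one. If \<open>v - 1\<close> is absent,
  no end is created. If only \<open>v\<close> is absent, the end \<open>v - 1\<close> is lost too,
  so again one run fewer remains.\<close>

lemma run_potential_remove_Max:
  assumes fin: "finite U" and U: "v + 1 \<in> U" "\<And>x. x \<in> U \<Longrightarrow> x \<le> v + 1" and "v \<ge> 1"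
  shows "run_potential (U - {v - 1, v, v + 1}) + 3 \<le> run_potential U"
proof -
  let ?U' = "U - {v - 1, v, v + 1}"
  note finE = finite_run_ends[OF fin]
  have less: "card ?U' < card U"
    using U fin by (intro psubset_card_mono) auto
  have last: "v + 1 \<in> run_ends U" "v + 1 \<notin> run_ends ?U'"
    using U(1) U(2)[of "v + 2"] by (auto simp: run_ends_def)
  have card_last: "Suc (card (run_ends U - {v + 1})) = card (run_ends U)"
    using finE last(1) by (rule card_Suc_Diff1)
  have sub: "run_ends ?U' \<subseteq> insert (v - 2) (run_ends U - {v + 1})"
    using run_ends_Diff_subset[of U v] last by auto
  consider "v \<in> U" "v - 1 \<in> U" | "v - 1 \<notin> U" | "v \<notin> U" "v - 1 \<in> U" by blast
  then show ?thesis
  proof cases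
    case 1
    have "card (run_ends ?U') \<le> card (insert (v - 2) (run_ends U - {v + 1}))"
      using sub finE by (intro card_mono) auto
    also have "\<dots> \<le> Suc (card (run_ends U - {v + 1}))"
      using finE by (simp add: card_insert_if)
    finally have "card (run_ends ?U') \<le> card (run_ends U)"
      using card_last by simp
    moreover have "card U = card ?U' + 3"
      using 1 U(1) \<open>v \<ge> 1\<close> fin
      by (subst card_Diff_subset)
        (auto simp: card_insert_if dest: card_mono[of U "{v - 1, v, v + 1}"])
    ultimately show ?thesis by (simp add: run_potential_def)
  next
    case 2
    then have "run_ends ?U' \<subseteq> run_ends U - {v + 1}"
      using \<open>v \<ge> 1\<close> by (auto simp: run_ends_def)
    then have "card (run_ends ?U') \<le> card (run_ends U - {v + 1})"
      using finE by (intro card_mono) auto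
    with card_last less show ?thesis by (simp add: run_potential_def)
  next
    case 3
    then have e: "v - 1 \<in> run_ends U - {v + 1}"
      using \<open>v \<ge> 1\<close> by (auto simp: run_ends_def)
    have "run_ends ?U' \<subseteq> insert (v - 2) (run_ends U - {v + 1} - {v - 1})"
      using sub by (auto simp: run_ends_def)
    then have "card (run_ends ?U') \<le> card (insert (v - 2) (run_ends U - {v + 1} - {v - 1}))"
      using finE by (intro card_mono) auto
    also have "\<dots> \<le> Suc (card (run_ends U - {v + 1} - {v - 1}))"
      using finE by (simp add: card_insert_if)
    also have "\<dots> = card (run_ends U - {v + 1})"
      using finE e by (intro card_Suc_Diff1) auto
    finally show ?thesis using card_last less by (simp add: run_potential_def)
  qed
qed

section \<open>Moves of both players on the path\<close>

lemma pverts_path_graph [simp]: "pverts (path_graph n) = {1..n}"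
  by (simp add: path_graph_def)

lemma open_nbhd_path_graph:
  "v \<in> {1..n} \<Longrightarrow> open_nbhd (path_graph n) v = {1..n} \<inter> {v - 1, v + 1}"
  by (auto simp: open_nbhd_def path_graph_def)

lemma closed_nbhd_path_graph:
  "v \<in> {1..n} \<Longrightarrow> closed_nbhd (path_graph n) v = {1..n} \<inter> {v - 1, v, v + 1}"
  by (auto simp: closed_nbhd_def open_nbhd_path_graph)

lemma undominated_path_graph_subset: "undominated (path_graph n) vs \<subseteq> {1..n}"
  by (auto simp: undominated_def)

lemma finite_undominated_path_graph: "finite (undominated (path_graph n) vs)"
  using undominated_path_graph_subset by (rule finite_subset) simp

lemma undominated_path_graph_snoc:
  "v \<in> {1..n} \<Longrightarrow>
    undominated (path_graph n) (vs @ [v]) = undominated (path_graph n) vs - {v - 1, v, v + 1}"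
  using undominated_path_graph_subset[of n vs]
  by (auto simp: undominated_snoc closed_nbhd_path_graph)

lemma z_legal_path_graph:
  "v \<in> z_legal (path_graph n) vs \<longleftrightarrow>
    v \<in> {1..n} \<and> (v - 1 \<in> undominated (path_graph n) vs \<or> v + 1 \<in> undominated (path_graph n) vs)"
  by (auto simp: z_legal_def undominated_def open_nbhd_path_graph)

lemma Dominator_move_path_graph:
  assumes "n \<ge> 2" and U: "undominated (path_graph n) vs \<noteq> {}"
  shows "\<exists>v \<in> z_legal (path_graph n) vs.
    run_potential (undominated (path_graph n) (vs @ [v])) + 3
      \<le> run_potential (undominated (path_graph n) vs)"
proof -
  let ?U = "undominated (path_graph n) vs"
  note fin = finite_undominated_path_graph[of n vs]
  define x where "x = Max ?U"
  have x: "x \<in> ?U" and max: "\<And>y. y \<in> ?U \<Longrightarrow> y \<le> x"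
    using fin U by (auto simp: x_def)
  have bounds: "x \<ge> 1" "x \<le> n"
    using x undominated_path_graph_subset[of n vs] by auto
  show ?thesis
  proof (cases "x = 1")
    \<comment> \<open>Here \<open>x - 1\<close> is not a vertex. Only 1 is undominated, the
      potential is 1 + 2 = 3, and playing 2 brings it to 0.\<close>
    case True
    then have U1: "?U = {1}"
      using x max undominated_path_graph_subset[of n vs] by fastforce
    then have "2 \<in> z_legal (path_graph n) vs"
      using \<open>n \<ge> 2\<close> by (simp add: z_legal_path_graph)
    moreover have "undominated (path_graph n) (vs @ [2]) = {}"
      using \<open>n \<ge> 2\<close> U1 by (simp add: undominated_path_graph_snoc)
    moreover have "run_ends {1} = {1}" by (auto simp: run_ends_def)
    ultimately show ?thesis
      using U1 by (intro bexI[of _ 2]) (simp_all add: run_potential_def run_ends_def)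
  next
    case False
    with bounds have "x - 1 \<in> {1..n}" "x - 1 + 1 = x" by auto
    then show ?thesis
      using x max fin run_potential_remove_Max[of ?U "x - 1"]
      by (intro bexI[of _ "x - 1"]) (simp_all add: undominated_path_graph_snoc z_legal_path_graph)
  qed
qed

text \<open>Walking from a played \<open>u\<close> towards an undominated vertex, let
  \<open>x\<close> be the first undominated one met. Its neighbour on the side of \<open>u\<close>
  is dominated by a played \<open>w\<close> that does not dominate \<open>x\<close>, so
  \<open>w\<close> is the next vertex beyond that neighbour. Playing the neighbour therefore newly
  dominates \<open>x\<close> alone.\<close>

lemma Staller_move_path_graph:
  assumes played: "vs \<noteq> []" "set vs \<subseteq> {1..n}" and U: "undominated (path_graph n) vs \<noteq> {}"
  shows "\<exists>v \<in> z_legal (path_graph n) vs.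
    card (undominated (path_graph n) vs) \<le> card (undominated (path_graph n) (vs @ [v])) + 1"
proof -
  let ?U = "undominated (path_graph n) vs"
  have dom: "y \<notin> ?U \<longleftrightarrow> (\<exists>u \<in> set vs. y \<in> {u - 1, u, u + 1})" if "y \<in> {1..n}" for y
    using that played(2) by (auto simp: undominated_def closed_nbhd_path_graph subset_iff)
  have self: "y \<notin> ?U" if "y \<in> set vs" for y
    using that by (auto simp: undominated_def closed_nbhd_def)
  \<comment> \<open>Here \<open>x\<close> has to be a neighbour of \<open>v\<close> rather than
    \<open>v\<close> itself, since legality looks at the open neighbourhood.\<close>
  have single: ?thesis
    if v: "v \<in> {1..n}" "x \<in> ?U" "x = v - 1 \<or> x = v + 1" "?U \<inter> {v - 1, v, v + 1} \<subseteq> {x}" for v x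
  proof -
    have "undominated (path_graph n) (vs @ [v]) = ?U - {x}"
      using v by (auto simp: undominated_path_graph_snoc)
    moreover have "v \<in> z_legal (path_graph n) vs"
      using v by (auto simp: z_legal_path_graph)
    ultimately show ?thesis
      using v(2) by (intro bexI[of _ v]) (simp_all add: finite_undominated_path_graph)
  qed
  obtain u where u: "u \<in> set vs" using played(1) by (cases vs) auto
  then have un: "u \<in> {1..n}" "u \<notin> ?U"
    using played(2) self by auto
  obtain y where y: "y \<in> ?U" using U by blast
  show ?thesis
  proof (cases "y > u")
    case True
    define x where "x = (LEAST z. z > u \<and> z \<in> ?U)"
    have x: "x > u" "x \<in> ?U"
      using LeastI[of "\<lambda>z. z > u \<and> z \<in> ?U" y] True y by (auto simp: x_def)
    have min: "x \<le> z" if "z > u" "z \<in> ?U" for z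
      using that by (auto simp: x_def intro: Least_le)
    have xn: "x \<in> {1..n}" using x undominated_path_graph_subset by blast
    have bnd: "x - 1 \<in> {1..n}" using x(1) un xn by auto
    have "x - 1 \<notin> ?U"
    proof
      assume mem: "x - 1 \<in> ?U"
      with un(2) have "x - 1 \<noteq> u" by auto
      with x(1) min[OF _ mem] show False by linarith
    qed
    then obtain w where w: "w \<in> set vs" "x - 1 \<in> {w - 1, w, w + 1}"
      using dom bnd by blast
    have "x \<notin> {w - 1, w, w + 1}" using dom[OF xn] x(2) w(1) by blast
    with w(2) bnd have "w = x - 2" by auto
    moreover have "w \<notin> ?U" using w(1) by (rule self)
    ultimately show ?thesis
      using single[of "x - 1" x] bnd x(2) \<open>x - 1 \<notin> ?U\<close> by (auto simp: numeral_2_eq_2)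
  next
    \<comment> \<open>Mirror image: \<open>y\<close> differs from \<open>u\<close> because
      \<open>u\<close> dominates itself, so an undominated vertex lies below
      \<open>u\<close>.\<close>
    case False
    define x where "x = Max {z \<in> ?U. z < u}"
    have "{z \<in> ?U. z < u} \<noteq> {}" using False y un(2) by (cases "y = u") auto
    then have x: "x < u" "x \<in> ?U"
      using Max_in[of "{z \<in> ?U. z < u}"] by (auto simp: x_def)
    have max: "z \<le> x" if "z < u" "z \<in> ?U" for z
      using that by (auto simp: x_def intro: Max_ge)
    have xn: "x \<in> {1..n}" using x undominated_path_graph_subset by blast
    have bnd: "x + 1 \<in> {1..n}" using x(1) un xn by auto
    have "x + 1 \<notin> ?U" using x(1) un(2) max[of "x + 1"] by (cases "x + 1 = u") auto
    then obtain w where w: "w \<in> set vs" "x + 1 \<in> {w - 1, w, w + 1}"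
      using dom bnd by blast
    have "x \<notin> {w - 1, w, w + 1}" using dom[OF xn] x(2) w(1) by blast
    with w(2) bnd have "w = x + 2" by auto
    moreover have "w \<notin> ?U" using w(1) by (rule self)
    ultimately show ?thesis
      using single[of "x + 1" x] bnd x(2) \<open>x + 1 \<notin> ?U\<close> by auto
  qed
qed

section \<open>The exact value on the path\<close>

lemma gamma_Zg_path_graph:
  assumes "n \<ge> 2"
  shows "gamma_Zg (path_graph n) = (n + 3) div 4 + n div 4"
proof (rule antisym)
  let ?G = "path_graph n"
  have start: "undominated ?G [] = {1..n}"
    by (simp add: undominated_def)
  have legal: "v \<in> {1..n}" if "v \<in> z_legal ?G vs" for v vs
    using that by (simp add: z_legal_path_graph)
  \<comment> \<open>The move built for Dominator also shows that play cannot stop before every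
    vertex is dominated.\<close>
  have playable: "z_legal ?G vs \<noteq> {} \<longleftrightarrow> undominated ?G vs \<noteq> {}" for vs
    using Dominator_move_path_graph[OF assms, of vs] by (auto simp: z_legal_path_graph)
  \<comment> \<open>The game starts with a single run, hence with potential n + 2. As (n + 4) div 4
    - 1 = n div 4, the resulting upper bound coincides with the lower bound, whose potential starts
    at n.\<close>
  have "run_ends {1..n} = {n}"
    using assms by (auto simp: run_ends_def)
  then have w0: "run_potential (undominated ?G []) = n + 2"
    by (simp add: start run_potential_def)
  have "z_remaining ?G Dominator [] \<le>
    (run_potential (undominated ?G []) + 1) div 4
      + (run_potential (undominated ?G []) + 2) div 4 - 1"
  proof (rule z_remaining_le_potential[of ?G "\<lambda>vs. run_potential (undominated ?G vs)" Dominator,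
        unfolded player.case])
    show "run_potential (undominated ?G (vs @ [v])) < run_potential (undominated ?G vs)"
      if "v \<in> z_legal ?G vs" for vs v
      using that run_potential_decreases[OF finite_undominated_path_graph]
      by (simp add: z_legal_path_graph undominated_path_graph_snoc)
  qed (use Dominator_move_path_graph[OF assms] playable in auto)
  then show "gamma_Zg ?G \<le> (n + 3) div 4 + n div 4"
    unfolding w0 by (simp add: gamma_Zg_def)
  have "(card (undominated ?G []) + 3) div 4 + card (undominated ?G []) div 4
      \<le> z_remaining ?G Dominator []"
  proof (rule z_remaining_ge_potential[of ?G "\<lambda>vs. card (undominated ?G vs)" "[]" Dominator,
        unfolded player.case])
    show "card (undominated ?G vs) \<le> card (undominated ?G (vs @ [v])) + 3"
      if "v \<in> z_legal ?G vs" for vs v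
    proof -
      have "card (undominated ?G vs) - card {v - 1, v, v + 1}
          \<le> card (undominated ?G vs - {v - 1, v, v + 1})"
        by (rule diff_card_le_card_Diff) simp
      moreover have "card {v - 1, v, v + 1} \<le> 3"
        by (simp add: card_insert_if)
      ultimately show ?thesis
        using legal[OF that] by (simp add: undominated_path_graph_snoc)
    qed
    show "\<exists>v \<in> z_legal ?G vs. card (undominated ?G vs) \<le> card (undominated ?G (vs @ [v])) + 1"
      if "vs \<noteq> []" "set vs \<subseteq> pverts ?G" "card (undominated ?G vs) > 0" for vs
      using that by (intro Staller_move_path_graph) auto
  qed (use playable in auto)
  then show "(n + 3) div 4 + n div 4 \<le> gamma_Zg ?G"
    by (simp add: gamma_Zg_def start)
qed

theorem corollary4p3:
  fixes n :: nat
  assumes "n \<ge> 2"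
  shows "int (gamma_Zg (path_graph n)) =
    (if n mod 4 = 3 then \<lceil>real n / 2\<rceil> - 1 else \<lceil>real n / 2\<rceil>)"
proof -
  have "\<lceil>real n / 2\<rceil> = int ((n + 1) div 2)"
    by (rule ceiling_unique) linarith+
  \<comment> \<open>The correction for residue 3 is added on the left, which avoids truncated
    subtraction; writing n as r + 4q leaves four cases.\<close>
  moreover have "(n + 3) div 4 + n div 4 + (if n mod 4 = 3 then 1 else 0) = (n + 1) div 2"
  proof -
    obtain q r where n: "n = r + 4 * q" "r < 4"
      by (metis mod_div_mult_eq mod_less_divisor mult.commute zero_less_numeral)
    then consider "r = 0" | "r = 1" | "r = 2" | "r = 3" by linarith
    then show ?thesis by cases (simp_all add: n, presburger?)
  qed
  ultimately show ?thesis
    by (simp add: gamma_Zg_path_graph[OF assms] split: if_splits)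
qed

end
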